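(* Let $d\ge 2$ and let $\mathbf{M}\subset\mathbf{E}^d$ be an almost smooth convex body. Then $I(\mathbf{M})\le 2^d$; that is, the Illumination Conjecture holds for almost smooth convex bodies.
   Context: $\mathbf{E}^d$ is $d$-dimensional Euclidean space with the standard inner product. A convex body in $\mathbf{E}^d$ is a compact convex set with non-empty interior. Almost smooth: for a convex body $\mathbf{M}\subset\mathbf{E}^d$ and a boundary point $b$ of $\mathbf{M}$, let $N_b$ denote the set of (nonzero) outer normal vectors of all supporting hyperplanes of $\mathbf{M}$ at $b$. $\mathbf{M}$ is called almost smooth if for each boundary point $b$ of $\mathbf{M}$ and any $\mathbf{n}_i,\mathbf{n}_j\in N_b$ one has $$\frac{\mathbf{n}_i\cdot\mathbf{n}_j}{\|\mathbf{n}_i\|\cdot\|\mathbf{n}_j\|}\ge\frac{d-2}{d-1}.$$ Illumination number: a boundary point $p$ of a convex body $\mathbf{K}\subset\mathbf{E}^d$ is illuminated by a direction (nonzero vector) $\mathbf{v}$ if $p+\lambda\mathbf{v}$ lies in the interior of $\mathbf{K}$ for some $\lambda>0$. $I(\mathbf{K})$ is the smallest number of directions such that every boundary point of $\mathbf{K}$ is illuminated by at least one of them. The Illumination Conjecture asserts that $I(\mathbf{K})\le 2^d$ for every convex body $\mathbf{K}\subset\mathbf{E}^d$. *)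

theory Defs
  imports "HOL-Analysis.Analysis" "HOL-Library.Extended_Nat"
begin

definition convex_body :: "'a::euclidean_space set \<Rightarrow> bool" where
  "convex_body M \<longleftrightarrow> compact M \<and> convex M \<and> interior M \<noteq> {}"

(* For b in M and n nonzero, the set {x. n \<bullet> x = n \<bullet> b} is a supporting hyperplane of M at b
   with outer normal n iff M lies in the closed half-space below. *)
definition outer_normals :: "'a::euclidean_space set \<Rightarrow> 'a \<Rightarrow> 'a set" where
  "outer_normals M b = {n. n \<noteq> 0 \<and> M \<subseteq> {x. n \<bullet> x \<le> n \<bullet> b}}"

definition almost_smooth :: "'a::euclidean_space set \<Rightarrow> bool" where
  "almost_smooth M \<longleftrightarrow>
     (\<forall>b\<in>frontier M. \<forall>m\<in>outer_normals M b. \<forall>n\<in>outer_normals M b.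
        (m \<bullet> n) / (norm m * norm n) \<ge> (real DIM('a) - 2) / (real DIM('a) - 1))"

definition illuminates :: "'a::euclidean_space set \<Rightarrow> 'a \<Rightarrow> 'a \<Rightarrow> bool" where
  "illuminates K v p \<longleftrightarrow> v \<noteq> 0 \<and> (\<exists>t>0. p + t *\<^sub>R v \<in> interior K)"

(* Valued in enat so that the infimum is infinite, rather than 0, when no finite set of
   directions illuminates the whole boundary. *)
definition illumination_number :: "'a::euclidean_space set \<Rightarrow> enat" where
  "illumination_number K =
     (INF D \<in> {D. finite D \<and> 0 \<notin> D \<and> (\<forall>p\<in>frontier K. \<exists>v\<in>D. illuminates K v p)}.
        enat (card D))"

end

theory Submission
  imports Defs
begin

text \<open>A direction illuminates a boundary point iff it has negative inner product with all outer
  normals there. By a spherical Jung argument, the unit normals at a boundary point lie in a cap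
  \<open>u \<bullet> n \<ge> \<surd>((d - 1) / d)\<close>, and the \<open>2\<^sup>d\<close> vertices of a cube are directions that settle all caps
  not centred at a coordinate vector. For \<open>d > 2\<close>, almost smoothness excludes failure at the
  remaining caps. For \<open>d = 2\<close> a failure forces two orthogonal normals \<open>f\<close>, \<open>g\<close> at one boundary
  point, and four other directions, adapted to \<open>f\<close> and \<open>g\<close>, illuminate the body.\<close>

section \<open>Illumination in terms of outer normals\<close>

text \<open>If the open ray from \<open>b\<close> along \<open>v\<close> missed the interior, a
  hyperplane separating the two would support \<open>M\<close> at \<open>b\<close>, and its outer
  normal \<open>a\<close> would satisfy \<open>0 \<le> a \<bullet> v\<close>.\<close>

lemma illuminatesI:
  fixes M :: "'a::euclidean_space set"
  assumes "convex_body M" "b \<in> frontier M" "v \<noteq> 0"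
    and neg: "\<And>n. n \<in> outer_normals M b \<Longrightarrow> v \<bullet> n < 0"
  shows "illuminates M v b"
proof (rule ccontr)
  define R where "R = (\<lambda>t. b + t *\<^sub>R v) ` {0<..}"
  assume "\<not> illuminates M v b"
  then have "interior M \<inter> R = {}"
    using \<open>v \<noteq> 0\<close> by (auto simp: illuminates_def R_def)
  have M: "convex M" "closed M" "interior M \<noteq> {}"
    using assms(1) by (auto simp: convex_body_def compact_imp_closed)
  have "R = (+) b ` (\<lambda>t. t *\<^sub>R v) ` {0<..}"
    by (auto simp: R_def)
  then have "convex R"
    by (simp add: convex_scaled convex_translation)
  moreover have "R \<noteq> {}" by (auto simp: R_def)
  ultimately obtain a k where "a \<noteq> 0" and a: "\<forall>x\<in>interior M. a \<bullet> x \<le> k" "\<forall>x\<in>R. a \<bullet> x \<ge> k"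
    using separating_hyperplane_sets[of "interior M" R] M \<open>interior M \<inter> R = {}\<close>
    by (metis convex_interior)
  have "closure (interior M) \<subseteq> {x. a \<bullet> x \<le> k}"
    using a by (intro closure_minimal closed_halfspace_le) auto
  then have le: "M \<subseteq> {x. a \<bullet> x \<le> k}"
    using M by (simp add: convex_closure_interior)
  have "b \<in> M"
    using assms(2) M by (simp add: frontier_def)
  have ge: "k \<le> a \<bullet> b + t * (a \<bullet> v)" if "t > 0" for t
    using a(2) that by (auto simp: R_def inner_add_right)
  \<comment> \<open>The ray omits \<open>b\<close>, so the bound reaches \<open>b\<close> only in
    the limit as \<open>t\<close> tends to 0.\<close>
  have "((\<lambda>t. a \<bullet> b + t * (a \<bullet> v)) \<longlongrightarrow> a \<bullet> b + 0 * (a \<bullet> v)) (at_right 0)"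
    by (intro tendsto_intros)
  moreover have "eventually (\<lambda>t::real. 0 < t) (at_right 0)"
    by (simp add: eventually_at_right_less)
  ultimately have "k \<le> a \<bullet> b + 0 * (a \<bullet> v)"
    using ge by (intro tendsto_lowerbound) (auto elim: eventually_mono)
  then have "a \<bullet> b = k"
    using le \<open>b \<in> M\<close> by auto
  then have "a \<in> outer_normals M b" "0 \<le> a \<bullet> v"
    using le \<open>a \<noteq> 0\<close> ge[of 1] by (auto simp: outer_normals_def)
  then show False
    using neg[of a] by (simp add: inner_commute)
qed

section \<open>A spherical Jung theorem\<close>

text \<open>In the double sum for \<open>p \<bullet> p\<close> the diagonal products are 1 and the
  others at least \<open>c\<close>; by Cauchy-Schwarz the diagonal weights
  \<open>(l x)\<^sup>2\<close> sum to at least \<open>1 / card T\<close>.\<close>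

lemma convex_combination_inner_self_ge:
  fixes p :: "'a::real_inner"
  assumes "finite T" "T \<noteq> {}" "\<And>x. x \<in> T \<Longrightarrow> norm x = 1"
    and "\<And>x y. x \<in> T \<Longrightarrow> y \<in> T \<Longrightarrow> c \<le> x \<bullet> y" "c \<le> 1"
    and l: "\<And>x. x \<in> T \<Longrightarrow> 0 \<le> l x" "sum l T = 1" and p: "p = (\<Sum>x\<in>T. l x *\<^sub>R x)"
  shows "c + (1 - c) / card T \<le> p \<bullet> p"
proof -
  have "c + (1 - c) / card T = c + (1 - c) * ((sum l T)\<^sup>2 / card T)"
    by (simp add: l)
  also have "\<dots> \<le> c + (1 - c) * (\<Sum>x\<in>T. (l x)\<^sup>2)"
    using sum_squared_le_sum_of_squares[of l T] assms(1,2,5)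
    by (intro add_left_mono mult_left_mono) (auto simp: field_simps card_gt_0_iff)
  also have "\<dots> = c * (\<Sum>x\<in>T. \<Sum>y\<in>T. l x * l y) + (1 - c) * (\<Sum>x\<in>T. \<Sum>y\<in>T. if x = y then (l x)\<^sup>2 else 0)"
    using assms(1) by (simp add: sum_product[symmetric] l)
  also have "\<dots> = (\<Sum>x\<in>T. \<Sum>y\<in>T. l x * l y * (if x = y then 1 else c))"
    by (auto simp: sum_distrib_left sum.distrib[symmetric] power2_eq_square algebra_simps intro!: sum.cong)
  also have "\<dots> \<le> (\<Sum>x\<in>T. \<Sum>y\<in>T. l x * l y * (x \<bullet> y))"
    using assms(3,4) l by (intro sum_mono mult_left_mono) (auto simp: dot_square_norm)
  also have "\<dots> = p \<bullet> p"
    by (simp add: p inner_sum_left inner_sum_right sum_distrib_left mult_ac inner_commute)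
  finally show ?thesis .
qed

text \<open>The point of the convex hull nearest to the origin lies in the convex hull of a part of \<open>S\<close>
  contained in a hyperplane, so Caratheodory's theorem there needs only \<open>DIM('a)\<close> points.\<close>

lemma spherical_jung:
  fixes S :: "'a::euclidean_space set"
  assumes "compact S" "S \<noteq> {}" and unit: "\<And>x. x \<in> S \<Longrightarrow> norm x = 1"
    and c: "\<And>x y. x \<in> S \<Longrightarrow> y \<in> S \<Longrightarrow> c \<le> x \<bullet> y" "0 \<le> c" "c \<le> 1"
  obtains u where "norm u = 1" "\<And>x. x \<in> S \<Longrightarrow> sqrt (c + (1 - c) / DIM('a)) \<le> u \<bullet> x"
proof -
  let ?d = "real DIM('a)"
  define p where "p = closest_point (convex hull S) 0"
  have hull: "closed (convex hull S)" "convex hull S \<noteq> {}"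
    using assms by (auto simp: compact_convex_hull compact_imp_closed)
  then have "p \<in> convex hull S"
    unfolding p_def by (rule closest_point_in_set)
  then obtain T l where T: "finite T" "T \<subseteq> S" "\<forall>x\<in>T. 0 \<le> l x" "sum l T = 1"
      "p = (\<Sum>x\<in>T. l x *\<^sub>R x)"
    unfolding convex_hull_explicit by auto
  have ge: "p \<bullet> p \<le> p \<bullet> x" if "x \<in> S" for x
    using closest_point_dot[of "convex hull S" x 0] hull(1) that
    by (simp add: p_def[symmetric] hull_inc inner_diff_right)
  define H where "H = {x \<in> S. p \<bullet> x = p \<bullet> p}"
  \<comment> \<open>\<open>p\<close> is the weighted mean of \<open>T\<close>, so the weighted
    excesses \<open>p \<bullet> x - p \<bullet> p\<close> sum to 0. None is negative by
    \<open>ge\<close>, hence only points of \<open>H\<close> carry weight.\<close>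
  have "(\<Sum>x\<in>T. l x * (p \<bullet> x - p \<bullet> p)) = p \<bullet> p - p \<bullet> p"
  proof -
    have "(\<Sum>x\<in>T. l x * (p \<bullet> x)) = p \<bullet> p"
      by (subst (3) T(5)) (simp add: inner_sum_right)
    then show ?thesis
      by (simp add: right_diff_distrib sum_subtractf sum_distrib_right[symmetric] T(4))
  qed
  then have "\<forall>x\<in>T. l x * (p \<bullet> x - p \<bullet> p) = 0"
    using T ge by (subst sum_nonneg_eq_0_iff[symmetric]) (auto simp: subset_iff)
  then have zero: "l x = 0" if "x \<in> T" "x \<notin> H" for x
    using that T(2) by (auto simp: H_def)
  have "p \<in> convex hull H"
    unfolding convex_hull_explicit
  proof (intro CollectI exI conjI)
    show "finite (T \<inter> H)" "T \<inter> H \<subseteq> H" "\<forall>x\<in>T \<inter> H. 0 \<le> l x"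
      using T by auto
    show "sum l (T \<inter> H) = 1"
      using sum.mono_neutral_right[of T "T \<inter> H" l] T zero by auto
    show "(\<Sum>x\<in>T \<inter> H. l x *\<^sub>R x) = p"
      using sum.mono_neutral_right[of T "T \<inter> H" "\<lambda>x. l x *\<^sub>R x"] T zero by auto
  qed
  then obtain U m where U: "finite U" "U \<subseteq> H" "card U \<le> aff_dim H + 1" "\<forall>x\<in>U. 0 \<le> m x" "sum m U = 1"
      "(\<Sum>x\<in>U. m x *\<^sub>R x) = p"
    unfolding convex_hull_caratheodory_aff_dim by auto
  have "U \<noteq> {}" using U(5) by auto
  have pU: "c + (1 - c) / card U \<le> p \<bullet> p"
  proof (rule convex_combination_inner_self_ge[of U _ m])
    have "U \<subseteq> S" using U(2) by (auto simp: H_def)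
    then show "norm x = 1" "c \<le> x \<bullet> y" if "x \<in> U" "y \<in> U" for x y
      using unit c(1) that by blast+
  qed (use U \<open>U \<noteq> {}\<close> c in auto)
  \<comment> \<open>The second term keeps the bound positive even for \<open>c = 0\<close>. Hence
    \<open>p\<close> is nonzero and \<open>H\<close> lies in a genuine hyperplane.\<close>
  have "0 < c + (1 - c) / card U"
    using c \<open>U \<noteq> {}\<close> U(1) by (cases "c = 0") (auto intro!: add_pos_nonneg simp: card_gt_0_iff)
  then have "p \<noteq> 0" using pU by auto
  have "aff_dim H \<le> aff_dim {x. p \<bullet> x = p \<bullet> p}"
    by (intro aff_dim_subset) (auto simp: H_def)
  also have "\<dots> = DIM('a) - 1"
    using \<open>p \<noteq> 0\<close> by simp
  finally have "card U \<le> DIM('a)" using U(3) by simp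
  then have "(1 - c) / ?d \<le> (1 - c) / card U"
    using c \<open>U \<noteq> {}\<close> U(1) by (intro divide_left_mono) (auto simp: card_gt_0_iff)
  then have "c + (1 - c) / ?d \<le> (norm p)\<^sup>2"
    using pU by (simp add: power2_norm_eq_inner)
  then have sq: "sqrt (c + (1 - c) / ?d) \<le> norm p"
    by (rule real_le_lsqrt[OF norm_ge_zero])
  show thesis
  proof
    show "norm (p /\<^sub>R norm p) = 1" using \<open>p \<noteq> 0\<close> by simp
    fix x assume "x \<in> S"
    then have "norm p * norm p \<le> p \<bullet> x"
      using ge by (simp flip: power2_eq_square power2_norm_eq_inner)
    then have "norm p \<le> (p /\<^sub>R norm p) \<bullet> x"
      using \<open>p \<noteq> 0\<close> by (simp add: field_simps)
    then show "sqrt (c + (1 - c) / ?d) \<le> (p /\<^sub>R norm p) \<bullet> x"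
      using sq by simp
  qed
qed

section \<open>The cone of outer normals and upper bounds for the illumination number\<close>

lemma outer_normals_scale:
  "n \<in> outer_normals M b \<Longrightarrow> 0 < r \<Longrightarrow> r *\<^sub>R n \<in> outer_normals M b"
  by (auto simp: outer_normals_def)

lemma outer_normals_add:
  "n \<in> outer_normals M b \<Longrightarrow> m \<in> outer_normals M b \<Longrightarrow> n + m \<noteq> 0 \<Longrightarrow> n + m \<in> outer_normals M b"
  by (fastforce simp: outer_normals_def inner_add_left intro: add_mono)

lemma compact_unit_outer_normals:
  fixes M :: "'a::euclidean_space set"
  shows "compact {n \<in> outer_normals M b. norm n = 1}"
proof -
  have "{n \<in> outer_normals M b. norm n = 1} = sphere 0 1 \<inter> (\<Inter>x\<in>M. {n. (x - b) \<bullet> n \<le> 0})"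
    by (auto simp: outer_normals_def inner_diff_left inner_diff_right inner_commute)
  then show ?thesis
    by (simp only:) (intro compact_Int_closed compact_sphere closed_INT ballI closed_halfspace_le)
qed

lemma illumination_number_le:
  assumes "finite D" "0 \<notin> D" "card D \<le> k"
    and "\<And>p. p \<in> frontier K \<Longrightarrow> \<exists>v\<in>D. illuminates K v p"
  shows "illumination_number K \<le> enat k"
proof -
  have "illumination_number K \<le> enat (card D)"
    unfolding illumination_number_def using assms by (intro INF_lower) auto
  then show ?thesis
    using assms(3) by (meson enat_ord_simps(1) order_trans)
qed

section \<open>Cube vertices as directions\<close>

definition cube_vertex :: "'a::euclidean_space set \<Rightarrow> 'a" where
  "cube_vertex T = (\<Sum>i\<in>Basis. (if i \<in> T then 1 else - 1) *\<^sub>R i)"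

lemma inner_cube_vertex:
  "i \<in> Basis \<Longrightarrow> cube_vertex T \<bullet> i = (if i \<in> T then 1 else - 1)"
  by (simp add: cube_vertex_def)

lemma cube_vertex_inner_self:
  "cube_vertex T \<bullet> (cube_vertex T :: 'a::euclidean_space) = DIM('a)"
proof -
  have "cube_vertex T \<bullet> (cube_vertex T :: 'a) = (\<Sum>i\<in>(Basis::'a set). 1)"
    by (subst euclidean_inner, rule sum.cong) (auto simp: inner_cube_vertex)
  then show ?thesis by simp
qed

lemma cube_vertex_nonzero: "cube_vertex T \<noteq> (0 :: 'a::euclidean_space)"
  using cube_vertex_inner_self[of T] by (metis DIM_positive inner_zero_left of_nat_0_less_iff less_irrefl)

text \<open>Meant for a cube vertex \<open>w\<close> with signs opposite to the cap centre
  \<open>u\<close>, where \<open>L\<close> is the l1-norm of \<open>u\<close>: if \<open>w\<close>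
  fails on the cap, this norm is small. Cauchy-Schwarz is applied to the components of
  \<open>n\<close> and \<open>w\<close> orthogonal to \<open>u\<close>.\<close>

lemma cap_cube_vertex_l1_le:
  fixes u w n :: "'a::real_inner"
  assumes "norm u = 1" "norm n = 1" "w \<bullet> w = d" "d > 0"
    and cap: "sqrt ((d - 1) / d) \<le> u \<bullet> n"  "1 \<le> d"
    and L: "w \<bullet> u = - L" "0 \<le> L" and nonneg: "0 \<le> w \<bullet> n"
  shows "L \<le> 1"
proof -
  define a where "a = u \<bullet> n"
  have uu: "u \<bullet> u = 1" "n \<bullet> n = 1"
    using assms by (simp_all add: dot_square_norm)
  have "0 \<le> sqrt ((d - 1) / d)" using assms by simp
  then have a: "0 \<le> a" "(d - 1) / d \<le> a\<^sup>2"
    using order_trans[OF _ cap(1)] sqrt_le_D[OF cap(1)] by (simp_all add: a_def)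
  have 1: "(n - a *\<^sub>R u) \<bullet> (w + L *\<^sub>R u) = w \<bullet> n + L * a"
    "(n - a *\<^sub>R u) \<bullet> (n - a *\<^sub>R u) = 1 - a\<^sup>2"
    "(w + L *\<^sub>R u) \<bullet> (w + L *\<^sub>R u) = d - L\<^sup>2"
    using uu L assms(3)
    by (simp_all add: algebra_simps a_def inner_commute power2_eq_square)
  have "(L * a)\<^sup>2 \<le> (w \<bullet> n + L * a)\<^sup>2"
    using a L nonneg by (intro power_mono) auto
  also have "\<dots> \<le> (1 - a\<^sup>2) * (d - L\<^sup>2)"
    using Cauchy_Schwarz_ineq[of "n - a *\<^sub>R u" "w + L *\<^sub>R u"] by (simp add: 1)
  finally have "L\<^sup>2 \<le> d - d * a\<^sup>2"
    by (simp add: algebra_simps power_mult_distrib)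
  moreover have "d - 1 \<le> d * a\<^sup>2"
    using a \<open>d > 0\<close> by (simp add: field_simps)
  ultimately have "L\<^sup>2 \<le> 1\<^sup>2" by simp
  then show ?thesis by (rule power2_le_imp_le) simp
qed

text \<open>If the cap of Jung's theorem is not centred at some \<open>\<plusminus>e\<^sub>i\<close>, the cube vertex closest to the
  antipode of its centre \<open>u\<close> works. Otherwise two cube vertices symmetric with respect to the line
  through \<open>u\<close> can only fail both if there are two normals at a large angle.\<close>

lemma cube_vertex_negative_on:
  fixes S :: "'a::euclidean_space set"
  assumes "compact S" and unit: "\<And>x. x \<in> S \<Longrightarrow> norm x = 1" and d: "DIM('a) \<ge> 2"
    and c: "\<And>x y. x \<in> S \<Longrightarrow> y \<in> S \<Longrightarrow> (real DIM('a) - 2) / (real DIM('a) - 1) \<le> x \<bullet> y"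
    and strict: "\<And>x y. x \<in> S \<Longrightarrow> y \<in> S \<Longrightarrow> (real DIM('a) - 2) / real DIM('a) < x \<bullet> y"
  shows "\<exists>T\<subseteq>Basis. \<forall>n\<in>S. cube_vertex T \<bullet> n < 0"
proof (cases "S = {}")
  case False
  let ?d = "real DIM('a)"
  have d2: "?d \<ge> 2" using d by simp
  \<comment> \<open>The almost smooth bound, inserted for \<open>c\<close> in
    \<open>spherical_jung\<close>, yields exactly the cap required by
    \<open>cap_cube_vertex_l1_le\<close>.\<close>
  have jung: "(?d - 2) / (?d - 1) + (1 - (?d - 2) / (?d - 1)) / ?d = (?d - 1) / ?d"
    using d2 by (simp add: divide_simps) algebra
  obtain u where u: "norm u = 1" and cap: "\<And>x. x \<in> S \<Longrightarrow> sqrt ((?d - 1) / ?d) \<le> u \<bullet> x"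
    using spherical_jung[OF assms(1) False unit c] d2 unfolding jung by auto
  \<comment> \<open>Both sign vectors are opposite to \<open>u\<close>; they differ exactly in the
    coordinates where \<open>u\<close> vanishes.\<close>
  define T1 where "T1 = {i \<in> Basis. u \<bullet> i \<le> 0}"
  define T2 where "T2 = {i \<in> Basis. u \<bullet> i < 0}"
  define w1 where "w1 = cube_vertex T1"
  define w2 where "w2 = cube_vertex T2"
  define L where "L = (\<Sum>i\<in>Basis. \<bar>u \<bullet> i\<bar>)"
  have wu: "w1 \<bullet> u = - L" "w2 \<bullet> u = - L"
    unfolding L_def sum_negf[symmetric]
    by (subst euclidean_inner,
        auto simp: w1_def w2_def T1_def T2_def inner_cube_vertex intro!: sum.cong)+
  have "1 \<le> L" using norm_le_l1[of u] u by (simp add: L_def)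
  have ww: "w1 \<bullet> w1 = ?d"
    by (simp_all add: w1_def cube_vertex_inner_self)
  show ?thesis
  proof (rule ccontr)
    assume contra: "\<not> ?thesis"
    have "T1 \<subseteq> Basis" "T2 \<subseteq> Basis" by (auto simp: T1_def T2_def)
    then obtain n1 n2 where n: "n1 \<in> S" "0 \<le> w1 \<bullet> n1" "n2 \<in> S" "0 \<le> w2 \<bullet> n2"
      using contra unfolding w1_def w2_def by (meson not_less)
    have "L \<le> 1"
      using cap_cube_vertex_l1_le[OF u unit[OF n(1)] ww _ cap[OF n(1)] _ wu(1) _ n(2)] d2 \<open>1 \<le> L\<close>
      by simp
    with \<open>1 \<le> L\<close> have "L = 1" by simp
    \<comment> \<open>On [-1, 1] the function \<open>\<bar>t\<bar> - t\<^sup>2\<close> is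
      nonnegative and vanishes only at -1, 0 and 1. So \<open>L = 1\<close> forces the unit vector
      \<open>u\<close> to be a basis vector up to sign.\<close>
    have "(\<Sum>i\<in>Basis. \<bar>u \<bullet> i\<bar> - (u \<bullet> i)\<^sup>2) = L - u \<bullet> u"
      by (simp add: L_def sum_subtractf euclidean_inner[of u u] power2_eq_square)
    also have "\<dots> = 0" using u \<open>L = 1\<close> by (simp add: dot_square_norm)
    finally have sq: "\<forall>i\<in>Basis. \<bar>u \<bullet> i\<bar> - (u \<bullet> i)\<^sup>2 = 0"
    proof (subst (asm) sum_nonneg_eq_0_iff)
      fix i :: 'a assume "i \<in> Basis"
      then have "\<bar>u \<bullet> i\<bar> \<le> 1" using Basis_le_norm[of i u] u by simp
      then have "\<bar>u \<bullet> i\<bar> * \<bar>u \<bullet> i\<bar> \<le> \<bar>u \<bullet> i\<bar> * 1"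
        by (intro mult_left_mono) auto
      then show "0 \<le> \<bar>u \<bullet> i\<bar> - (u \<bullet> i)\<^sup>2"
        by (simp add: power2_eq_square)
    qed auto
    then have u01: "u \<bullet> i = 0 \<or> \<bar>u \<bullet> i\<bar> = 1" if "i \<in> Basis" for i
    proof -
      have "\<bar>u \<bullet> i\<bar> * (1 - \<bar>u \<bullet> i\<bar>) = 0"
        using bspec[OF sq that] by (simp only: right_diff_distrib power2_eq_square abs_mult_self)
      then show ?thesis unfolding mult_eq_0_iff by auto
    qed
    \<comment> \<open>Thus \<open>w1 + u\<close> and \<open>w2 + u\<close> are opposite: the two
      vertices are reflections of each other in the line through \<open>u\<close>.\<close>
    have "w1 + w2 = - 2 *\<^sub>R u"
    proof (rule euclidean_eqI)
      fix i :: 'a assume i: "i \<in> Basis"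
      then show "(w1 + w2) \<bullet> i = (- 2 *\<^sub>R u) \<bullet> i"
        using u01[OF i]
        by (auto simp: w1_def w2_def T1_def T2_def inner_add_left inner_cube_vertex abs_if
            split: if_splits)
    qed
    then have w2: "w2 = - (w1 + u) - u"
      by (simp add: algebra_simps scaleR_2 eq_neg_iff_add_eq_0)
    have wnorm: "(w1 + u) \<bullet> (w1 + u) = ?d - 1"
      using ww wu(1) \<open>L = 1\<close> u inner_commute[of u w1] dot_square_norm[of u]
      by (simp add: inner_add_left inner_add_right)
    \<comment> \<open>The failures put \<open>n1\<close> and \<open>n2\<close> at least
      \<open>a\<close> to opposite sides along \<open>w1 + u\<close>. Cauchy-Schwarz then gives a
      squared distance of at least \<open>4 / d\<close>, that is, \<open>n1 \<bullet> n2\<close> at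
      most \<open>(d - 2) / d\<close>, contrary to \<open>strict\<close>.\<close>
    define a where "a = sqrt ((?d - 1) / ?d)"
    have "a \<le> (w1 + u) \<bullet> n1" "a \<le> - ((w1 + u) \<bullet> n2)"
      using n cap[OF n(1)] cap[OF n(3)] unfolding w2 a_def
      by (simp_all add: inner_add_left inner_diff_left)
    then have "2 * a \<le> (w1 + u) \<bullet> (n1 - n2)"
      by (simp add: inner_diff_right)
    then have "(2 * a)\<^sup>2 \<le> ((w1 + u) \<bullet> (n1 - n2))\<^sup>2"
      using d2 by (intro power_mono) (auto simp: a_def)
    also have "\<dots> \<le> (?d - 1) * ((n1 - n2) \<bullet> (n1 - n2))"
      using Cauchy_Schwarz_ineq[of "w1 + u" "n1 - n2"] by (simp add: wnorm)
    also have "(n1 - n2) \<bullet> (n1 - n2) = 2 - 2 * (n1 \<bullet> n2)"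
      using unit[OF n(1)] unit[OF n(3)] dot_square_norm[of n1] dot_square_norm[of n2]
      by (simp add: inner_diff_left inner_diff_right inner_commute)
    also have "(2 * a)\<^sup>2 = (?d - 1) * (4 / ?d)"
      using d2 by (simp add: a_def power_mult_distrib)
    finally have "4 / ?d \<le> 2 - 2 * (n1 \<bullet> n2)"
      using d2 by (subst (asm) mult_le_cancel_left_pos) auto
    moreover have "1 - 2 / ?d < n1 \<bullet> n2"
      using strict[OF n(1,3)] d2 by (simp add: diff_divide_distrib)
    ultimately show False by simp
  qed
qed auto

text \<open>Positive rescaling of a normal keeps the sign of its inner product with a direction, so
  the compact set of unit normals at each point suffices.\<close>

lemma illumination_number_le_cube:
  fixes M :: "'a::euclidean_space set"
  assumes d: "DIM('a) \<ge> 2" and M: "convex_body M" "almost_smooth M"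
    and strict: "\<And>b m n. b \<in> frontier M \<Longrightarrow> m \<in> outer_normals M b \<Longrightarrow> n \<in> outer_normals M b \<Longrightarrow>
      norm m = 1 \<Longrightarrow> norm n = 1 \<Longrightarrow> (real DIM('a) - 2) / real DIM('a) < m \<bullet> n"
  shows "illumination_number M \<le> enat (2 ^ DIM('a))"
proof (rule illumination_number_le)
  let ?D = "(cube_vertex :: _ \<Rightarrow> 'a) ` Pow Basis"
  show "finite ?D" by simp
  show "0 \<notin> ?D" using cube_vertex_nonzero by (metis imageE)
  show "card ?D \<le> 2 ^ DIM('a)"
    using card_image_le[of "Pow (Basis :: 'a set)" cube_vertex] by (simp add: card_Pow)
  fix b assume b: "b \<in> frontier M"
  define S where "S = {n \<in> outer_normals M b. norm n = 1}"
  have "\<exists>T\<subseteq>Basis. \<forall>n\<in>S. cube_vertex T \<bullet> n < 0"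
  proof (rule cube_vertex_negative_on)
    show "compact S"
      unfolding S_def by (rule compact_unit_outer_normals)
    show "(real DIM('a) - 2) / (real DIM('a) - 1) \<le> x \<bullet> y" if "x \<in> S" "y \<in> S" for x y
      using M(2) b that unfolding almost_smooth_def S_def by fastforce
  qed (use d b strict in \<open>auto simp: S_def\<close>)
  then obtain T where T: "T \<subseteq> Basis" "\<And>n. n \<in> S \<Longrightarrow> cube_vertex T \<bullet> n < 0" by auto
  have "illuminates M (cube_vertex T) b"
  proof (rule illuminatesI[OF M(1) b cube_vertex_nonzero])
    fix n assume n: "n \<in> outer_normals M b"
    then have "n \<noteq> 0" by (auto simp: outer_normals_def)
    then have "n /\<^sub>R norm n \<in> S"
      using outer_normals_scale[OF n, of "inverse (norm n)"] by (simp add: S_def)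
    then have "cube_vertex T \<bullet> (n /\<^sub>R norm n) < 0" by (rule T)
    then show "cube_vertex T \<bullet> n < 0"
      using \<open>n \<noteq> 0\<close> by (simp add: field_simps)
  qed
  then show "\<exists>v\<in>?D. illuminates M v b" using T by auto
qed

section \<open>The plane, with two orthogonal normals at one boundary point\<close>

text \<open>In coordinates along \<open>f\<close> and \<open>g\<close>, \<open>(x, y)\<close> is a
  normal on which \<open>f + g\<close> fails and \<open>(x', y')\<close> one on which
  \<open>2 *\<^sub>R g - f\<close> fails. If \<open>y' < 0\<close>, they form an obtuse angle; the
  factor 2, or any above 1, makes this strict. Otherwise they lie on the two positive axes and their
  sum enters the open quadrant.\<close>

lemma quadrant_avoiding_contradiction:
  fixes x y x' y' :: real
  assumes "0 < x" "0 \<le> x + y" "y \<le> 0" "x' \<noteq> 0 \<or> y' \<noteq> 0" "x' \<le> 2 * y'" "\<not> (0 < x' \<and> 0 < y')"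
    and "0 \<le> x' * x + y' * y" "\<not> (0 < x' + x \<and> 0 < y' + y)"
  shows False
proof (cases "y' < 0")
  case True
  then have "y' * y \<le> y' * (- x)" using assms True by (intro mult_left_mono_neg) auto
  moreover have "x' * x \<le> (2 * y') * x" using assms by (intro mult_right_mono) auto
  ultimately have "0 \<le> y' * x" using assms(7) by (simp add: mult.assoc)
  then show False using True assms(1) by (simp add: zero_le_mult_iff)
next
  case False
  then have "x' \<le> 0" using assms by linarith
  then have "x' * x \<le> 0" "y' * y \<le> 0"
    using False assms by (auto simp: mult_le_0_iff)
  then have "x' * x = 0" "y' * y = 0" using assms by linarith+
  then show False using assms False by auto
qed

text \<open>All outer normals at the other boundary points avoid the open quadrant spanned by \<open>f\<close> and
  \<open>g\<close>, which leaves enough room for three directions to illuminate them.\<close>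

lemma illumination_number_le_plane:
  fixes M :: "'a::euclidean_space set"
  assumes d: "DIM('a) = 2" and M: "convex_body M" "almost_smooth M"
    and b: "b \<in> frontier M" and fg: "f \<in> outer_normals M b" "g \<in> outer_normals M b"
      "norm f = 1" "norm g = 1" "f \<bullet> g = 0"
  shows "illumination_number M \<le> enat 4"
proof -
  have ff: "f \<bullet> f = 1" "g \<bullet> g = 1" "g \<bullet> f = 0"
    using fg by (simp_all add: dot_square_norm inner_commute)
  have span: "span {f, g} = UNIV"
  proof (rule dim_eq_full[THEN iffD1])
    have "f \<noteq> g" using ff fg by auto
    have "independent {f, g}"
      using ff fg by (intro pairwise_orthogonal_independent)
        (auto simp: pairwise_def orthogonal_def inner_commute)
    then show "dim {f, g} = DIM('a)"
      using \<open>f \<noteq> g\<close> d by (simp add: dim_eq_card_independent)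
  qed
  have zero: "z = 0" if "f \<bullet> z = 0" "g \<bullet> z = 0" for z
  proof -
    have "orthogonal z z"
      using orthogonal_to_span[of z "{f, g}" z] that span
      by (auto simp: orthogonal_def inner_commute)
    then show ?thesis by (simp add: orthogonal_self)
  qed
  have "z = (f \<bullet> z) *\<^sub>R f + (g \<bullet> z) *\<^sub>R g" for z
    using zero[of "z - ((f \<bullet> z) *\<^sub>R f + (g \<bullet> z) *\<^sub>R g)"] ff fg
    by (simp add: inner_diff_right inner_add_right)
  then have inner: "m \<bullet> n = (f \<bullet> m) * (f \<bullet> n) + (g \<bullet> m) * (g \<bullet> n)" for m n
    by (metis inner_add_left inner_scaleR_left)
  \<comment> \<open>For d = 2 the almost smooth bound is 0: normals at a common point never form an
    obtuse angle.\<close>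
  have nonneg: "0 \<le> m \<bullet> n"
    if "p \<in> frontier M" "m \<in> outer_normals M p" "n \<in> outer_normals M p" for p m n
  proof -
    have "0 \<le> (m \<bullet> n) / (norm m * norm n)"
      using M(2) that d unfolding almost_smooth_def by fastforce
    moreover have "0 < norm m * norm n" using that by (auto simp: outer_normals_def)
    ultimately show ?thesis by (simp add: zero_le_divide_iff)
  qed
  have sub: "frontier M \<subseteq> M"
    using M(1) by (simp add: convex_body_def frontier_subset_compact)
  \<comment> \<open>\<open>- f - g\<close> serves \<open>b\<close>, the other three directions serve
    the remaining points. The list form bounds the cardinality without a proof of
    distinctness.\<close>
  let ?D = "set [- f - g, f + g, 2 *\<^sub>R f - g, 2 *\<^sub>R g - f]"
  show ?thesis
  proof (rule illumination_number_le)
    show "finite ?D" by simp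
    have "f \<bullet> v \<noteq> 0" if "v \<in> ?D" for v
      using that ff fg by (auto simp: inner_diff_right inner_add_right)
    then show nz: "0 \<notin> ?D" by force
    show "card ?D \<le> 4"
      using card_length[of "[- f - g, f + g, 2 *\<^sub>R f - g, 2 *\<^sub>R g - f]"] by simp
    fix p assume p: "p \<in> frontier M"
    let ?N = "outer_normals M p"
    have n0: "f \<bullet> n \<noteq> 0 \<or> g \<bullet> n \<noteq> 0" if "n \<in> ?N" for n
      using zero[of n] that by (auto simp: outer_normals_def)
    have "\<exists>v\<in>?D. \<forall>n\<in>?N. v \<bullet> n < 0"
    proof (cases "\<exists>n\<in>?N. 0 < f \<bullet> n \<and> 0 < g \<bullet> n")
      case True
      \<comment> \<open>\<open>f\<close> and \<open>g\<close> support \<open>M\<close> at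
        \<open>b\<close>, so \<open>p - b\<close> has no positive coordinate; \<open>n\<close>
        supports \<open>M\<close> at \<open>p\<close>, so \<open>n \<bullet> (p - b)\<close> is
        nonnegative. Both coordinates must vanish.\<close>
      then obtain n where n: "n \<in> ?N" "0 < f \<bullet> n" "0 < g \<bullet> n" by blast
      have "f \<bullet> (p - b) \<le> 0" "g \<bullet> (p - b) \<le> 0" "0 \<le> n \<bullet> (p - b)"
        using fg n sub p b by (auto simp: outer_normals_def inner_diff_right)
      moreover have "n \<bullet> (p - b) = (f \<bullet> n) * (f \<bullet> (p - b)) + (g \<bullet> n) * (g \<bullet> (p - b))"
        by (rule inner)
      moreover have "(f \<bullet> n) * (f \<bullet> (p - b)) \<le> 0" "(g \<bullet> n) * (g \<bullet> (p - b)) \<le> 0"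
        using calculation n by (simp_all add: mult_le_0_iff)
      ultimately have "(f \<bullet> n) * (f \<bullet> (p - b)) = 0" "(g \<bullet> n) * (g \<bullet> (p - b)) = 0"
        by linarith+
      then have "p = b" using zero[of "p - b"] n by simp
      have "(- f - g) \<bullet> m < 0" if "m \<in> ?N" for m
      proof -
        have "0 \<le> f \<bullet> m" "0 \<le> g \<bullet> m"
          using nonneg[OF b] fg that \<open>p = b\<close> by auto
        then show ?thesis using n0[OF that] by (auto simp: inner_diff_left)
      qed
      then show ?thesis by auto
    next
      case False
      show ?thesis
      proof (rule ccontr)
        assume contra: "\<not> ?thesis"
        obtain n1 where n1: "n1 \<in> ?N" "0 \<le> (2 *\<^sub>R f - g) \<bullet> n1"
          using contra by (auto simp: not_less)
        obtain n2 where n2: "n2 \<in> ?N" "0 \<le> (2 *\<^sub>R g - f) \<bullet> n2"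
          using contra by (auto simp: not_less)
        obtain n3 where n3: "n3 \<in> ?N" "0 \<le> (f + g) \<bullet> n3"
          using contra by (auto simp: not_less)
        \<comment> \<open>A nonzero sum of normals at \<open>p\<close> is again a normal, so it
          avoids the open quadrant too.\<close>
        have add: "\<not> (0 < f \<bullet> n + f \<bullet> n3 \<and> 0 < g \<bullet> n + g \<bullet> n3)" if "n \<in> ?N" for n
        proof
          assume *: "0 < f \<bullet> n + f \<bullet> n3 \<and> 0 < g \<bullet> n + g \<bullet> n3"
          then have "n + n3 \<noteq> 0" by (auto simp flip: inner_add_right)
          then have "n + n3 \<in> ?N" using outer_normals_add that n3(1) by blast
          then show False using False * by (auto simp: inner_add_right)
        qed
        have dot: "0 \<le> (f \<bullet> n) * (f \<bullet> n3) + (g \<bullet> n) * (g \<bullet> n3)" if "n \<in> ?N" for n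
          using nonneg[OF p that n3(1)] by (simp only: inner[of n n3])
        \<comment> \<open>The two cases are mirror images under exchanging \<open>f\<close> and
          \<open>g\<close>; \<open>n3\<close> is paired with \<open>n2\<close> in the first and with
          \<open>n1\<close> in the second.\<close>
        have "0 < f \<bullet> n3 \<or> 0 < g \<bullet> n3"
          using n3(2) n0[OF n3(1)] by (auto simp: inner_add_left)
        then show False
        proof
          assume "0 < f \<bullet> n3"
          then have "g \<bullet> n3 \<le> 0" using False n3(1) by force
          show False
            by (rule quadrant_avoiding_contradiction[of "f \<bullet> n3" "g \<bullet> n3" "f \<bullet> n2" "g \<bullet> n2"])
              (use \<open>0 < f \<bullet> n3\<close> \<open>g \<bullet> n3 \<le> 0\<close> n2 n3(2) n0[OF n2(1)] False add[OF n2(1)] dot[OF n2(1)]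
                in \<open>auto simp: inner_add_left inner_diff_left\<close>)
        next
          assume "0 < g \<bullet> n3"
          then have "f \<bullet> n3 \<le> 0" using False n3(1) by force
          show False
            by (rule quadrant_avoiding_contradiction[of "g \<bullet> n3" "f \<bullet> n3" "g \<bullet> n1" "f \<bullet> n1"])
              (use \<open>0 < g \<bullet> n3\<close> \<open>f \<bullet> n3 \<le> 0\<close> n1 n3(2) n0[OF n1(1)] False add[OF n1(1)] dot[OF n1(1)]
                in \<open>auto simp: inner_add_left inner_diff_left\<close>)
        qed
      qed
    qed
    then obtain v where "v \<in> ?D" "\<And>n. n \<in> ?N \<Longrightarrow> v \<bullet> n < 0" by blast
    then show "\<exists>v\<in>?D. illuminates M v p"
      using illuminatesI[OF M(1) p] nz by metis
  qed
qed

theorem mainTheorem5: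
  fixes M :: "'a::euclidean_space set"
  assumes "DIM('a) \<ge> 2"
    and "convex_body M"
    and "almost_smooth M"
  shows "illumination_number M \<le> 2 ^ DIM('a)"
proof -
  have pow: "(2::enat) ^ DIM('a) = enat (2 ^ DIM('a))"
    by (simp add: of_nat_eq_enat[symmetric])
  show ?thesis
  proof (cases "\<exists>b\<in>frontier M. \<exists>m\<in>outer_normals M b. \<exists>n\<in>outer_normals M b.
      norm m = 1 \<and> norm n = 1 \<and> m \<bullet> n \<le> (real DIM('a) - 2) / real DIM('a)")
    case False
    then have "illumination_number M \<le> enat (2 ^ DIM('a))"
      using illumination_number_le_cube[OF assms] by (metis not_less)
    then show ?thesis by (simp only: pow)
  next
    case True
    then obtain b m n where b: "b \<in> frontier M" and mn: "m \<in> outer_normals M b" "n \<in> outer_normals M b"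
        "norm m = 1" "norm n = 1" "m \<bullet> n \<le> (real DIM('a) - 2) / real DIM('a)"
      by blast
    have ge: "(real DIM('a) - 2) / (real DIM('a) - 1) \<le> m \<bullet> n"
      using assms(3) b mn unfolding almost_smooth_def by fastforce
    \<comment> \<open>The bounds on \<open>m \<bullet> n\<close> from both sides share the numerator
      d - 2. They contradict each other for d > 2, and for d = 2 both are 0, which makes
      \<open>m\<close> and \<open>n\<close> orthogonal.\<close>
    have "DIM('a) = 2"
    proof (rule ccontr)
      assume "DIM('a) \<noteq> 2"
      with assms(1) have "real DIM('a) > 2" by simp
      then have "(real DIM('a) - 2) / real DIM('a) < (real DIM('a) - 2) / (real DIM('a) - 1)"
        by (intro divide_strict_left_mono) auto
      with ge mn show False by simp
    qed
    then have "m \<bullet> n = 0" using ge mn by simp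
    then show ?thesis
      using illumination_number_le_plane[OF \<open>DIM('a) = 2\<close> assms(2,3) b mn(1-4)] \<open>DIM('a) = 2\<close>
      unfolding pow by simp
  qed
qed

end
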